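(* Let $r\ge1$ be an integer and let $q,x$ be indeterminates. Put $M^q(x,n)=\frac1n\sum_{d\mid n}\mu^q(n,d)\,q^{d-1}x^d$ for $n\ge1$, and let $f_r^q$ be the $q$-restriction operator $q\text{-}{\rm Res}_{\hat C^r}^{\hat C}$ on sequences over $\mathbb Q[x,q]$. Then for every $n\ge1$ the $n$-th component of $f_r^q\bigl((M^q(x,m))_{m\ge1}\bigr)$ is given by $$\sum_{d\mid n}Q_{r,n,d}(q)\,M^q(x^r,d)\qquad(\text{in }\mathbb Q[x,q]),$$ where the $Q_{r,n,d}(q)\in\mathbb Q[q]$ are numerical polynomials.
   Context: $\mu^q(n,d)\in\mathbb Q[q]$ denotes the $(n,d)$-entry of the inverse of the matrix indexed by positive integers whose $(n,d)$-entry is $q^{n/d-1}$ if $d\mid n$ and $0$ otherwise. $M^q(x^r,d)$ is the polynomial $M^q(x,d)$ with $x$ replaced by $x^r$. Let $\varphi^q:\mathbb Q[x,q]^{\mathbb N}\to\mathbb Q[x,q]^{\mathbb N}$ be the bijection $(b_n)_{n\ge1}\mapsto\bigl(\sum_{d\mid n}d\,q^{n/d-1}b_d\bigr)_{n\ge1}$ and $\mathcal F_r:(c_n)_{n\ge1}\mapsto(c_{rn})_{n\ge1}$. The $q$-restriction from the profinite completion $\hat C$ of the infinite cyclic group to its open subgroup $\hat C^r$ of index $r$ (open subgroups of $\hat C$ and of $\hat C^r$ being indexed by their index in $\hat C$, resp. $\hat C^r$) is $f_r^q=(\varphi^q)^{-1}\circ\mathcal F_r\circ\varphi^q$. A numerical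 polynomial is a polynomial in $\mathbb Q[q]$ taking integer values at all integers. *)

theory Defs
  imports "HOL-Computational_Algebra.Polynomial" "HOL-Library.FuncSet"
begin

(* Q[q] is the type rat poly, and Q[x,q] = Q[q][x] is the type rat poly poly. *)

definition var_q :: "rat poly poly" where
  "var_q = [:[:0, 1:]:]"

definition var_x :: "rat poly poly" where
  "var_x = [:0, 1:]"

definition numerical_poly :: "rat poly \<Rightarrow> bool" where
  "numerical_poly p \<longleftrightarrow> (\<forall>k::int. poly p (of_int k) \<in> \<int>)"

(* Matrices indexed by the positive integers are functions on nat vanishing when an index is 0.
   The inverse is taken in the ring of row-finite matrices. *)

definition row_finite :: "(nat \<Rightarrow> nat \<Rightarrow> 'a::comm_ring_1) \<Rightarrow> bool" where
  "row_finite A \<longleftrightarrow> (\<forall>n d. n = 0 \<or> d = 0 \<longrightarrow> A n d = 0) \<and> (\<forall>n. finite {d. A n d \<noteq> 0})"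

definition matrix_prod ::
    "(nat \<Rightarrow> nat \<Rightarrow> 'a::comm_ring_1) \<Rightarrow> (nat \<Rightarrow> nat \<Rightarrow> 'a) \<Rightarrow> nat \<Rightarrow> nat \<Rightarrow> 'a" where
  "matrix_prod A B n d = (\<Sum>k | A n k \<noteq> 0. A n k * B k d)"

definition matrix_one :: "nat \<Rightarrow> nat \<Rightarrow> 'a::comm_ring_1" where
  "matrix_one n d = (if n \<ge> 1 \<and> n = d then 1 else 0)"

definition is_matrix_inverse ::
    "(nat \<Rightarrow> nat \<Rightarrow> 'a::comm_ring_1) \<Rightarrow> (nat \<Rightarrow> nat \<Rightarrow> 'a) \<Rightarrow> bool" where
  "is_matrix_inverse A B \<longleftrightarrow>
     row_finite B \<and> matrix_prod A B = matrix_one \<and> matrix_prod B A = matrix_one"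

definition zeta_q :: "nat \<Rightarrow> nat \<Rightarrow> rat poly" where
  "zeta_q n d = (if n \<ge> 1 \<and> d dvd n then [:0, 1:] ^ (n div d - 1) else 0)"

definition mu_q :: "nat \<Rightarrow> nat \<Rightarrow> rat poly" where
  "mu_q = (THE B. is_matrix_inverse zeta_q B)"

definition M_q :: "nat \<Rightarrow> rat poly poly" where
  "M_q n = smult [:1 / of_nat n:] (\<Sum>d | d dvd n. [:mu_q n d:] * var_q ^ (d - 1) * var_x ^ d)"

(* The value of a sequence (b_n), n >= 1, at the index 0 is fixed to be undefined, so that
   phi_q is a bijection of seqs. *)

definition seqs :: "(nat \<Rightarrow> rat poly poly) set" where
  "seqs = {1..} \<rightarrow>\<^sub>E UNIV"

definition phi_q :: "(nat \<Rightarrow> rat poly poly) \<Rightarrow> nat \<Rightarrow> rat poly poly" where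
  "phi_q b = (\<lambda>n\<in>{1..}. \<Sum>d | d dvd n. of_nat d * var_q ^ (n div d - 1) * b d)"

definition F_op :: "nat \<Rightarrow> (nat \<Rightarrow> rat poly poly) \<Rightarrow> nat \<Rightarrow> rat poly poly" where
  "F_op r c = (\<lambda>n\<in>{1..}. c (r * n))"

definition q_Res :: "nat \<Rightarrow> (nat \<Rightarrow> rat poly poly) \<Rightarrow> nat \<Rightarrow> rat poly poly" where
  "q_Res r = inv_into seqs phi_q \<circ> F_op r \<circ> phi_q"


subsection \<open>The inverses above exist\<close>

lemma matrix_prod_superset:
  assumes "finite S" "\<And>k. A n k \<noteq> 0 \<Longrightarrow> k \<in> S"
  shows "matrix_prod A B n d = (\<Sum>k\<in>S. A n k * B k d)"
  unfolding matrix_prod_def by (rule sum.mono_neutral_left) (use assms in auto)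

lemma matrix_prod_assoc:
  assumes "row_finite A" "row_finite B"
  shows "matrix_prod (matrix_prod A B) C = matrix_prod A (matrix_prod B C)"
proof (intro ext)
  fix n d
  define K where "K = {k. A n k \<noteq> 0}"
  define L where "L = (\<Union>k\<in>K. {l. B k l \<noteq> 0})"
  have finK: "finite K" and finL: "finite L"
    using assms unfolding K_def L_def row_finite_def by auto
  have AB: "matrix_prod A B n l = (\<Sum>k\<in>K. A n k * B k l)" for l
    by (simp add: matrix_prod_def K_def)
  have sup: "l \<in> L" if "matrix_prod A B n l \<noteq> 0" for l
  proof (rule ccontr)
    assume "l \<notin> L"
    then have "\<forall>k\<in>K. B k l = 0" by (auto simp: L_def)
    with that show False by (simp add: AB)
  qed
  have "matrix_prod (matrix_prod A B) C n d = (\<Sum>l\<in>L. (\<Sum>k\<in>K. A n k * B k l) * C l d)"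
    by (subst matrix_prod_superset[OF finL]) (erule sup, simp only: AB)
  also have "\<dots> = (\<Sum>k\<in>K. \<Sum>l\<in>L. A n k * (B k l * C l d))"
    by (subst sum.swap) (simp add: sum_distrib_right mult.assoc)
  also have "\<dots> = (\<Sum>k\<in>K. A n k * matrix_prod B C k d)"
  proof (rule sum.cong)
    fix k assume k: "k \<in> K"
    have "matrix_prod B C k d = (\<Sum>l\<in>L. B k l * C l d)"
      by (rule matrix_prod_superset[OF finL]) (use k in \<open>auto simp: L_def\<close>)
    then show "(\<Sum>l\<in>L. A n k * (B k l * C l d)) = A n k * matrix_prod B C k d"
      by (simp add: sum_distrib_left)
  qed simp
  also have "\<dots> = matrix_prod A (matrix_prod B C) n d"
    by (simp add: matrix_prod_def[of A "matrix_prod B C"] K_def)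
  finally show "matrix_prod (matrix_prod A B) C n d = matrix_prod A (matrix_prod B C) n d" .
qed

lemma matrix_prod_one_right:
  assumes "row_finite A"
  shows "matrix_prod A matrix_one = A"
proof (intro ext)
  fix n d
  have fin: "finite {k. A n k \<noteq> 0}" and z: "A n 0 = 0"
    using assms by (auto simp: row_finite_def)
  have "matrix_prod A matrix_one n d = (\<Sum>k | A n k \<noteq> 0. if k = d then A n k else 0)"
    unfolding matrix_prod_def by (rule sum.cong) (use z in \<open>auto simp: matrix_one_def not_less_eq_eq\<close>)
  also have "\<dots> = A n d" using fin by (simp add: sum.delta)
  finally show "matrix_prod A matrix_one n d = A n d" .
qed

lemma matrix_prod_one_left:
  assumes "row_finite A"
  shows "matrix_prod matrix_one A = A"
proof (intro ext)
  fix n d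
  have "matrix_prod matrix_one A n d = (\<Sum>k\<in>{n}. matrix_one n k * A k d)"
    by (rule matrix_prod_superset) (auto simp: matrix_one_def split: if_splits)
  also have "\<dots> = A n d" using assms by (auto simp: matrix_one_def row_finite_def not_less_eq_eq)
  finally show "matrix_prod matrix_one A n d = A n d" .
qed

definition unitriangular :: "(nat \<Rightarrow> nat \<Rightarrow> 'a::comm_ring_1) \<Rightarrow> bool" where
  "unitriangular A \<longleftrightarrow> (\<forall>n d. n = 0 \<or> \<not> d dvd n \<longrightarrow> A n d = 0) \<and> (\<forall>n\<ge>1. A n n = 1)"

lemma unitriangular_zero:
  assumes "unitriangular A" "n = 0 \<or> \<not> d dvd n"
  shows "A n d = 0"
  by (rule assms(1)[unfolded unitriangular_def, THEN conjunct1, rule_format, OF assms(2)])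

lemma unitriangular_row_finite:
  assumes "unitriangular A"
  shows "row_finite A"
  unfolding row_finite_def
proof (intro conjI allI impI)
  show "A n d = 0" if "n = 0 \<or> d = 0" for n d
    by (rule unitriangular_zero[OF assms]) (use that in \<open>cases "n = 0"; simp\<close>)
  show "finite {d. A n d \<noteq> 0}" for n
  proof (rule finite_subset)
    show "{d. A n d \<noteq> 0} \<subseteq> {..n}"
    proof
      fix d assume d: "d \<in> {d. A n d \<noteq> 0}"
      have "\<not> (n = 0 \<or> \<not> d dvd n)"
      proof
        assume "n = 0 \<or> \<not> d dvd n"
        from unitriangular_zero[OF assms this] d show False by simp
      qed
      then show "d \<in> {..n}" using dvd_imp_le[of d n] by simp
    qed
  qed simp
qed

function rinv :: "(nat \<Rightarrow> nat \<Rightarrow> 'a::comm_ring_1) \<Rightarrow> nat \<Rightarrow> nat \<Rightarrow> 'a" where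
  "rinv A n d = (if n = 0 \<or> \<not> d dvd n then 0 else if n = d then 1
     else - (\<Sum>k | k dvd n \<and> k < n. A n k * rinv A k d))"
  by auto
termination by (relation "measure (\<lambda>(A, n, d). n)") auto

declare rinv.simps [simp del]

lemma unitriangular_rinv: "unitriangular (rinv A)"
  unfolding unitriangular_def
proof (intro conjI allI impI)
  show "rinv A n d = 0" if "n = 0 \<or> \<not> d dvd n" for n d
    by (subst rinv.simps) (use that in auto)
  show "rinv A n n = 1" if "n \<ge> 1" for n
    by (subst rinv.simps) (use that in auto)
qed

lemma matrix_prod_rinv:
  assumes "unitriangular A"
  shows "matrix_prod A (rinv A) = matrix_one"
proof (intro ext)
  fix n d
  show "matrix_prod A (rinv A) n d = matrix_one n d"
  proof (cases "n = 0")
    case True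
    then show ?thesis using assms by (simp add: matrix_prod_def matrix_one_def unitriangular_def)
  next
    case False
    have split: "{k. k dvd n} = insert n {k. k dvd n \<and> k < n}"
      using False by (auto dest: dvd_imp_le)
    have Ann: "A n n = 1" using assms False by (auto simp: unitriangular_def)
    have "matrix_prod A (rinv A) n d = (\<Sum>k | k dvd n. A n k * rinv A k d)"
      by (rule matrix_prod_superset) (use assms False in \<open>auto simp: unitriangular_def\<close>)
    also have "\<dots> = rinv A n d + (\<Sum>k | k dvd n \<and> k < n. A n k * rinv A k d)"
      unfolding split by (subst sum.insert) (use False Ann in auto)
    also have "\<dots> = matrix_one n d"
    proof (cases "d dvd n \<and> n \<noteq> d")
      case True
      then have "rinv A n d = - (\<Sum>k | k dvd n \<and> k < n. A n k * rinv A k d)"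
        using False by (subst rinv.simps) simp
      with True show ?thesis by (simp add: matrix_one_def)
    next
      case nd: False
      have "rinv A k d = 0" if "k dvd n" "k < n" for k
      proof -
        have "\<not> d dvd k"
        proof
          assume "d dvd k"
          then have "d dvd n" using that(1) by (rule dvd_trans)
          then have "n dvd k" using nd \<open>d dvd k\<close> by simp
          then show False
            using that dvd_imp_le[of n k] dvd_pos_nat[of n k] False by simp
        qed
        then show ?thesis by (simp add: rinv.simps[of A k d])
      qed
      then have "(\<Sum>k | k dvd n \<and> k < n. A n k * rinv A k d) = 0"
        by (intro sum.neutral) auto
      moreover have "rinv A n d = matrix_one n d"
        using nd False by (subst rinv.simps) (auto simp: matrix_one_def)
      ultimately show ?thesis by simp
    qed
    finally show ?thesis .
  qed
qed

lemma unitriangular_ex1_inverse: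
  fixes A :: "nat \<Rightarrow> nat \<Rightarrow> 'a::comm_ring_1"
  assumes "unitriangular A"
  shows "\<exists>!B. is_matrix_inverse A B"
proof -
  define B where "B = rinv A"
  have rA: "row_finite A" and rB: "row_finite B" and rC: "row_finite (rinv B)"
    using assms unitriangular_rinv unitriangular_row_finite unfolding B_def by blast+
  have AB: "matrix_prod A B = matrix_one"
    unfolding B_def by (rule matrix_prod_rinv[OF assms])
  have BC: "matrix_prod B (rinv B) = matrix_one"
    by (rule matrix_prod_rinv) (simp add: B_def unitriangular_rinv)
  have "A = matrix_prod A (matrix_prod B (rinv B))"
    by (simp add: BC matrix_prod_one_right[OF rA])
  also have "\<dots> = rinv B"
    by (simp add: matrix_prod_assoc[OF rA rB, symmetric] AB matrix_prod_one_left[OF rC])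
  finally have "A = rinv B" .
  then have BA: "matrix_prod B A = matrix_one" using BC by simp
  show ?thesis
  proof
    show "is_matrix_inverse A B" using AB BA rB by (simp add: is_matrix_inverse_def)
  next
    fix B' assume "is_matrix_inverse A B'"
    then have rB': "row_finite B'" and BA': "matrix_prod B' A = matrix_one"
      by (auto simp: is_matrix_inverse_def)
    have "B' = matrix_prod B' (matrix_prod A B)"
      by (simp add: AB matrix_prod_one_right[OF rB'])
    also have "\<dots> = B"
      by (simp add: matrix_prod_assoc[OF rB' rA, symmetric] BA' matrix_prod_one_left[OF rB])
    finally show "B' = B" .
  qed
qed

lemma mu_q_inverse: "is_matrix_inverse zeta_q mu_q"
proof -
  have "unitriangular zeta_q" by (auto simp: unitriangular_def zeta_q_def)
  from theI'[OF unitriangular_ex1_inverse[OF this]] show ?thesis by (simp add: mu_q_def)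
qed

lemma phi_q_split:
  assumes "n \<ge> 1"
  shows "phi_q b n = of_nat n * b n +
           (\<Sum>d | d dvd n \<and> d < n. of_nat d * var_q ^ (n div d - 1) * b d)"
proof -
  have split: "{k. k dvd n} = insert n {k. k dvd n \<and> k < n}"
    using assms by (auto dest: dvd_imp_le)
  show ?thesis
    using assms by (simp add: phi_q_def split)
qed

function psi_q :: "(nat \<Rightarrow> rat poly poly) \<Rightarrow> nat \<Rightarrow> rat poly poly" where
  "psi_q c n = (if n = 0 then undefined else smult [:1 / of_nat n:]
     (c n - (\<Sum>d | d dvd n \<and> d < n. of_nat d * var_q ^ (n div d - 1) * psi_q c d)))"
  by auto
termination by (relation "measure snd") auto

declare psi_q.simps [simp del]

lemma of_nat_mult_smult_inverse:
  "n \<ge> 1 \<Longrightarrow> of_nat n * smult [:1 / of_nat n:] p = (p :: rat poly poly)"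
  by (simp add: of_nat_poly pCons_one)

lemma bij_betw_phi_q: "bij_betw phi_q seqs seqs"
proof (rule bij_betw_imageI)
  show "inj_on phi_q seqs"
  proof (rule inj_onI)
    fix b b' assume bb: "b \<in> seqs" "b' \<in> seqs" and eq: "phi_q b = phi_q b'"
    have "n \<ge> 1 \<Longrightarrow> b n = b' n" for n
    proof (induction n rule: less_induct)
      case (less n)
      have "b d = b' d" if "d dvd n" "d < n" for d
      proof (rule less.IH)
        show "d \<ge> 1" using that less.prems by (cases d) auto
      qed fact
      then have "(\<Sum>d | d dvd n \<and> d < n. of_nat d * var_q ^ (n div d - 1) * b d)
          = (\<Sum>d | d dvd n \<and> d < n. of_nat d * var_q ^ (n div d - 1) * b' d)"
        by (intro sum.cong) auto
      then have "of_nat n * b n = of_nat n * b' n"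
        using fun_cong[OF eq, of n]
        by (simp only: phi_q_split[OF less.prems] add_right_cancel)
      then show ?case using less.prems by simp
    qed
    then show "b = b'" using bb unfolding seqs_def by (intro PiE_ext) auto
  qed
  show "phi_q ` seqs = seqs"
  proof
    show "phi_q ` seqs \<subseteq> seqs" by (auto simp: seqs_def phi_q_def)
    show "seqs \<subseteq> phi_q ` seqs"
    proof
      fix c assume c: "c \<in> seqs"
      have "psi_q c \<in> seqs" by (auto simp: seqs_def psi_q.simps PiE_def extensional_def)
      moreover have "phi_q (psi_q c) = c"
      proof
        fix n
        show "phi_q (psi_q c) n = c n"
        proof (cases "n \<ge> 1")
          case True
          have psi: "psi_q c n = smult [:1 / of_nat n:]
              (c n - (\<Sum>d | d dvd n \<and> d < n. of_nat d * var_q ^ (n div d - 1) * psi_q c d))"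
            by (subst psi_q.simps) (use True in \<open>simp split del: if_split\<close>)
          have "of_nat n * psi_q c n =
              c n - (\<Sum>d | d dvd n \<and> d < n. of_nat d * var_q ^ (n div d - 1) * psi_q c d)"
            by (subst psi) (rule of_nat_mult_smult_inverse[OF True])
          then show ?thesis
            by (simp only: phi_q_split[OF True] diff_add_cancel)
        next
          case False
          then show ?thesis using c by (auto simp: phi_q_def seqs_def PiE_def extensional_def)
        qed
      qed
      ultimately show "c \<in> phi_q ` seqs" by (metis imageI)
    qed
  qed
qed

end

theory Submission
  imports Defs "HOL-Computational_Algebra.Formal_Power_Series"
begin

(* Applying phi_q to (M^q(x,m))_m gives (q^(m-1) x^m)_m, and from this
   Q_{r,n,d}(q) = M^q(q^((r-1)d), n/d).  So it suffices that M^q(x,n) is an integer for all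
   integers q, x.  For q = 0 this is immediate.  For q \<noteq> 0 the numbers b_d = M^q(x,d) satisfy
   1 - q x t = \<Prod>_d (1 - q t^d)^(b_d), and both sides live in the multiplicative group
   1 + q t Z[[t]]; comparing coefficients successively gives b_d \<in> Z. *)

section \<open>Logarithmic derivatives of power series in 1 + q X Z[[X]]\<close>

text \<open>The sequences \<^term>\<open>w\<close> of logarithmic derivatives \<^term>\<open>- X * f' / f\<close> with
  \<^term>\<open>f\<close> in the group \<open>1 + q X Z[[X]]\<close>.\<close>

definition log_derivs :: "int \<Rightarrow> int fps set" where
  "log_derivs q = {w. \<exists>f. fps_nth f 0 = 1 \<and> (\<forall>n\<ge>1. q dvd fps_nth f n) \<and>
     fps_X * fps_deriv f = - (w * f)}"

lemma log_derivs_zero: "0 \<in> log_derivs q"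
  unfolding log_derivs_def by (rule CollectI, rule exI[of _ 1]) auto

text \<open>Logarithmic derivatives add under multiplication of series. The product stays in the
  group because every term of a coefficient of positive index contains a factor of positive index,
  which \<open>q\<close> divides.\<close>

lemma log_derivs_add:
  assumes "v \<in> log_derivs q" "w \<in> log_derivs q"
  shows "v + w \<in> log_derivs q"
proof -
  obtain f where f: "fps_nth f 0 = 1" "\<And>n. n \<ge> 1 \<Longrightarrow> q dvd fps_nth f n"
    "fps_X * fps_deriv f = - (v * f)"
    using assms(1) by (auto simp: log_derivs_def)
  obtain g where g: "fps_nth g 0 = 1" "\<And>n. n \<ge> 1 \<Longrightarrow> q dvd fps_nth g n"
    "fps_X * fps_deriv g = - (w * g)"
    using assms(2) by (auto simp: log_derivs_def)
  have "q dvd fps_nth (f * g) n" if "n \<ge> 1" for n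
    unfolding fps_mult_nth
  proof (rule dvd_sum)
    fix i assume "i \<in> {0..n}"
    then have "i \<ge> 1 \<or> n - i \<ge> 1" using that by auto
    then show "q dvd fps_nth f i * fps_nth g (n - i)"
      using f(2) g(2) by (auto intro: dvd_mult dvd_mult2)
  qed
  moreover have "fps_X * fps_deriv (f * g) =
      (fps_X * fps_deriv f) * g + f * (fps_X * fps_deriv g)"
    by (simp add: algebra_simps)
  then have "fps_X * fps_deriv (f * g) = - ((v + w) * (f * g))"
    unfolding f(3) g(3) by (simp add: algebra_simps)
  ultimately show ?thesis
    unfolding log_derivs_def using f(1) g(1) by (intro CollectI exI[of _ "f * g"]) auto
qed

lemma log_derivs_sum:
  assumes "\<And>i. i \<in> I \<Longrightarrow> w i \<in> log_derivs q"
  shows "(\<Sum>i\<in>I. w i) \<in> log_derivs q"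
  using assms by (induction I rule: infinite_finite_induct) (auto intro: log_derivs_zero log_derivs_add)

text \<open>For \<open>d \<ge> 1\<close> this is the expansion of 1/(1 - a X^d).\<close>

definition geometric :: "int \<Rightarrow> nat \<Rightarrow> int fps" where
  "geometric a d = Abs_fps (\<lambda>n. if d dvd n then a ^ (n div d) else 0)"

lemma geometric_inverse:
  assumes "d \<ge> 1"
  shows "geometric a d * (1 - fps_const a * fps_X ^ d) = 1"
proof (rule fps_ext)
  fix n
  have "fps_nth (geometric a d * (1 - fps_const a * fps_X ^ d)) n =
      fps_nth (geometric a d) n - a * fps_nth (fps_X ^ d * geometric a d) n"
    by (simp add: algebra_simps)
  also have "\<dots> = fps_nth 1 n"
  proof (cases "n < d")
    case True
    then show ?thesis using assms
      by (auto simp: geometric_def fps_X_power_mult_nth dest: dvd_imp_le)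
  next
    case False
    then have "d dvd n \<Longrightarrow> n div d = Suc ((n - d) div d)"
      using assms by (simp add: le_div_geq)
    then show ?thesis using False assms
      by (auto simp: geometric_def fps_X_power_mult_nth dvd_minus_self)
  qed
  finally show "fps_nth (geometric a d * (1 - fps_const a * fps_X ^ d)) n = fps_nth 1 n" .
qed

text \<open>Here \<open>w\<close> is d a X^d / (1 - a X^d), which is -X f'/f for f = 1 - a X^d. The
  inverse series \<open>g\<close> of \<open>f\<close> has the opposite logarithmic derivative, and
  both lie in the group since \<open>q\<close> divides \<open>a\<close>.\<close>

lemma log_derivs_geometric:
  assumes "d \<ge> 1" "q dvd a"
  defines "w \<equiv> of_nat d * (geometric a d - 1)"
  shows "w \<in> log_derivs q" "- w \<in> log_derivs q"
proof -
  define f where "f = 1 - fps_const a * fps_X ^ d"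
  define g where "g = geometric a d"
  have gf: "g * f = 1"
    unfolding f_def g_def by (rule geometric_inverse[OF assms(1)])
  have "fps_X * fps_deriv f = - (of_nat d * (fps_const a * fps_X ^ d))"
  proof (rule fps_ext)
    show "fps_nth (fps_X * fps_deriv f) n =
        fps_nth (- (of_nat d * (fps_const a * fps_X ^ d))) n" for n
      by (cases n) (auto simp: f_def simp flip: fps_of_nat)
  qed
  \<comment> \<open>As \<open>g * f = 1\<close>, the term a X^d = 1 - f equals
    \<open>g * f - f\<close>, which exposes the factor \<open>f\<close>.\<close>
  also have "\<dots> = - (of_nat d * (g * f - f))"
    unfolding gf by (simp add: f_def)
  also have "\<dots> = - (w * f)"
    by (simp add: w_def g_def algebra_simps)
  finally have f': "fps_X * fps_deriv f = - (w * f)" .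
  \<comment> \<open>Differentiating \<open>g * f = 1\<close> yields the derivative of
    \<open>g\<close>; the factor \<open>f\<close> can be cancelled since it is nonzero in a
    domain.\<close>
  have "0 = fps_X * fps_deriv (g * f)" by (simp add: gf)
  also have "\<dots> = (fps_X * fps_deriv g) * f + g * (fps_X * fps_deriv f)"
    by (simp add: algebra_simps)
  also have "\<dots> = (fps_X * fps_deriv g - w * g) * f"
    unfolding f' by (simp add: algebra_simps)
  finally have "(fps_X * fps_deriv g - w * g) * f = 0" by simp
  then have "fps_X * fps_deriv g = w * g"
    using gf by auto
  then have g': "fps_X * fps_deriv g = - ((- w) * g)" by simp
  have f01: "fps_nth f 0 = 1" "\<forall>n\<ge>1. q dvd fps_nth f n"
    using assms(1,2) by (auto simp: f_def)
  have g01: "fps_nth g 0 = 1" "\<forall>n\<ge>1. q dvd fps_nth g n"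
  proof -
    have "q dvd a ^ (n div d)" if "n \<ge> 1" "d dvd n" for n
    proof -
      have "n div d \<noteq> 0" using that assms(1) by (auto elim!: dvdE)
      then show ?thesis using assms(2) by (auto intro: dvd_trans dvd_power)
    qed
    then show "fps_nth g 0 = 1" "\<forall>n\<ge>1. q dvd fps_nth g n"
      by (auto simp: g_def geometric_def)
  qed
  show "w \<in> log_derivs q" unfolding log_derivs_def using f' f01 by blast
  show "- w \<in> log_derivs q" unfolding log_derivs_def using g' g01 by blast
qed

text \<open>This is the logarithmic derivative of (1 - q X^d)^c. Closure under addition suffices: a
  negative \<open>c\<close> is handled by adding copies of \<open>- ?w\<close>.\<close>

lemma log_derivs_of_int_geometric:
  assumes "d \<ge> 1"
  shows "of_int c * (of_nat d * (geometric q d - 1)) \<in> log_derivs q" (is "of_int c * ?w \<in> _")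
proof (cases "c \<ge> 0")
  case True
  have "(\<Sum>i<nat c. ?w) \<in> log_derivs q"
    by (rule log_derivs_sum) (rule log_derivs_geometric[OF assms dvd_refl])
  then show ?thesis using True by (simp only: sum_constant card_lessThan of_nat_nat)
next
  case False
  have "(\<Sum>i<nat (- c). - ?w) \<in> log_derivs q"
    by (rule log_derivs_sum) (rule log_derivs_geometric[OF assms dvd_refl])
  then show ?thesis using False by (simp only: sum_constant card_lessThan of_nat_nat) simp
qed

text \<open>Compare coefficients at X^n in X f' = - w f. As \<open>w\<close> starts at index
  \<open>n\<close> and \<open>f\<close> has constant term 1, the right side gives minus the
  coefficient of \<open>w\<close>; the left side is \<open>n\<close> times a coefficient of
  \<open>f\<close>, itself a multiple of \<open>q\<close>.\<close>

lemma log_derivs_leading_coeff: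
  assumes "w \<in> log_derivs q" "n \<ge> 1" "\<And>m. m < n \<Longrightarrow> fps_nth w m = 0"
  shows "int n * q dvd fps_nth w n"
proof -
  obtain f where f: "fps_nth f 0 = 1" "\<And>n. n \<ge> 1 \<Longrightarrow> q dvd fps_nth f n"
    "fps_X * fps_deriv f = - (w * f)"
    using assms(1) by (auto simp: log_derivs_def)
  have "fps_nth (w * f) n = (\<Sum>i\<in>{0..n}. if i = n then fps_nth w n else 0)"
    unfolding fps_mult_nth by (rule sum.cong) (use assms(3) f(1) in auto)
  also have "\<dots> = fps_nth w n" by simp
  finally have "fps_nth w n = - fps_nth (fps_X * fps_deriv f) n"
    using f(3) by simp
  also have "\<dots> = - (int n * fps_nth f n)"
    using assms(2) by (cases n) auto
  finally show ?thesis using f(2)[OF assms(2)] by simp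
qed

section \<open>Integrality of the solutions of the q-necklace equations\<close>

lemma q_necklace_solution_Ints:
  fixes q x :: int and b :: "nat \<Rightarrow> rat"
  assumes b: "\<And>n. n \<ge> 1 \<Longrightarrow>
    (\<Sum>d | d dvd n. of_nat d * of_int q ^ (n div d - 1) * b d) = of_int (q ^ (n - 1) * x ^ n)"
  assumes "n \<ge> 1"
  shows "b n \<in> \<int>"
proof (cases "q = 0")
  case True
  have fin: "finite {d. d dvd n}" using assms(2) by simp
  \<comment> \<open>For \<open>q = 0\<close> only the exponent 0 contributes, with 0^0 = 1, so the
    term \<open>d = n\<close> alone survives.\<close>
  have "of_int (q ^ (n - 1) * x ^ n) = (\<Sum>d | d dvd n. if d = n then of_nat n * b n else 0)"
    unfolding b[OF assms(2), symmetric]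
  proof (rule sum.cong)
    fix d assume "d \<in> {d. d dvd n}"
    then have "n div d - 1 = 0 \<longleftrightarrow> d = n" using assms(2)
      by (auto elim!: dvdE simp: le_Suc_eq)
    then show "of_nat d * of_int q ^ (n div d - 1) * b d = (if d = n then of_nat n * b n else 0)"
      using True by (cases "n div d - 1") auto
  qed simp
  also have "\<dots> = of_nat n * b n" using fin by simp
  finally have eq: "of_nat n * b n = of_int (q ^ (n - 1) * x ^ n)" by simp
  show ?thesis
  proof (cases "n = 1")
    case False
    then have "b n = 0" using eq True assms(2) by (simp add: zero_power)
    then show ?thesis by simp
  qed (use eq in simp)
next
  case q: False
  from assms(2) show ?thesis
  proof (induction n rule: less_induct)
    case (less n)
    define D where "D = {1..<n}"
    \<comment> \<open>By the induction hypothesis the floor is exact on \<open>D\<close>; it only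
      changes the type to \<open>int\<close>.\<close>
    define c where "c d = \<lfloor>b d\<rfloor>" for d
    have c: "of_int (c d) = b d" if "d \<in> D" for d
      using less.IH[of d] that by (auto simp: c_def D_def)
    \<comment> \<open>The logarithmic derivative of (1 - q x X) / \<Prod>_{d<n} (1 - q X^d)^(b_d).
      Dividing out the factors below \<open>n\<close> should leave a series whose first possible
      nontrivial coefficient is at index \<open>n\<close>.\<close>
    define w where "w = of_nat 1 * (geometric (q * x) 1 - 1) +
      (\<Sum>d\<in>D. of_int (- c d) * (of_nat d * (geometric q d - 1)))"
    have w: "w \<in> log_derivs q"
      unfolding w_def
    proof (rule log_derivs_add)
      show "of_nat 1 * (geometric (q * x) 1 - 1) \<in> log_derivs q"
        by (rule log_derivs_geometric) auto
      show "(\<Sum>d\<in>D. of_int (- c d) * (of_nat d * (geometric q d - 1))) \<in> log_derivs q"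
        by (rule log_derivs_sum) (rule log_derivs_of_int_geometric, simp add: D_def)
    qed
    have w0: "fps_nth w 0 = 0"
      unfolding w_def
      by (simp add: fps_sum_nth geometric_def flip: fps_of_nat fps_of_int)
    have wm: "of_int (fps_nth w m) = of_int q * of_nat m * (if m = n then b n else 0)"
      if m: "m \<ge> 1" "m \<le> n" for m
    proof -
      have "of_int (fps_nth w m) = (of_int q * of_int x) ^ m -
          (\<Sum>d\<in>D. if d dvd m then of_nat d * of_int q ^ (m div d) * b d else 0)"
      proof -
        have "fps_nth w m = (q * x) ^ m +
            (\<Sum>d\<in>D. - c d * (int d * (if d dvd m then q ^ (m div d) else 0)))"
          using m unfolding w_def
          by (simp add: fps_sum_nth geometric_def flip: fps_of_nat fps_of_int)
        also have "rat_of_int \<dots> = (of_int q * of_int x) ^ m +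
            (\<Sum>d\<in>D. - (if d dvd m then of_nat d * of_int q ^ (m div d) * b d else 0))"
          unfolding of_int_add of_int_sum
          by (intro arg_cong2[of _ _ _ _ "(+)"] sum.cong) (auto simp flip: c)
        finally show ?thesis by (simp add: sum_negf)
      qed
      also have "(\<Sum>d\<in>D. if d dvd m then of_nat d * of_int q ^ (m div d) * b d else 0) =
          (\<Sum>d | d dvd m \<and> d \<noteq> n. of_nat d * of_int q ^ (m div d) * b d)"
      proof (rule sum.mono_neutral_cong_right)
        show "{d. d dvd m \<and> d \<noteq> n} \<subseteq> D"
        proof
          fix d assume d: "d \<in> {d. d dvd m \<and> d \<noteq> n}"
          then have "d \<le> m" "d \<noteq> 0" using m by (auto dest: dvd_imp_le)
          with d m show "d \<in> D" by (auto simp: D_def)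
        qed
      qed (auto simp: D_def)
      \<comment> \<open>The equation for \<open>m\<close>, multiplied by \<open>q\<close>. Its terms
        with \<open>d \<noteq> n\<close> cancel against the sum just rewritten, so only
        \<open>d = n\<close> can remain, and only when \<open>m = n\<close>.\<close>
      also have "(of_int q * of_int x) ^ m =
          of_int q * (\<Sum>d | d dvd m. of_nat d * of_int q ^ (m div d - 1) * b d)"
        unfolding b[OF m(1)] using m(1) by (cases m) (auto simp: power_mult_distrib)
      also have "\<dots> = (\<Sum>d | d dvd m. of_nat d * of_int q ^ (m div d) * b d)"
        unfolding sum_distrib_left
      proof (rule sum.cong)
        fix d assume "d \<in> {d. d dvd m}"
        then have "m div d \<noteq> 0" using m(1) by (auto elim!: dvdE)
        then show "of_int q * (of_nat d * of_int q ^ (m div d - 1) * b d) =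
            of_nat d * of_int q ^ (m div d) * b d"
          by (cases "m div d") auto
      qed simp
      also have "\<dots> = (\<Sum>d | d dvd m \<and> d \<noteq> n. of_nat d * of_int q ^ (m div d) * b d) +
          (if m = n then of_int q * of_nat n * b n else 0)"
      proof (cases "m = n")
        case True
        have "{d. d dvd n} = insert n {d. d dvd n \<and> d \<noteq> n}" by auto
        moreover have "finite {d. d dvd n \<and> d \<noteq> n}" using m True by simp
        ultimately have "(\<Sum>d | d dvd n. of_nat d * of_int q ^ (n div d) * b d) =
            of_nat n * of_int q ^ (n div n) * b n +
            (\<Sum>d | d dvd n \<and> d \<noteq> n. of_nat d * of_int q ^ (n div d) * b d)"
          using sum.insert by fastforce
        then show ?thesis using True m by simp
      next
        case False
        then have "\<not> n dvd m" using m by (auto dest: dvd_imp_le)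
        then have "{d. d dvd m} = {d. d dvd m \<and> d \<noteq> n}" by auto
        then show ?thesis using False by simp
      qed
      finally show ?thesis by simp
    qed
    have "fps_nth w m = 0" if "m < n" for m
      using wm[of m] w0 that by (cases m) auto
    \<comment> \<open>The coefficient of \<open>w\<close> at \<open>n\<close> is q n b_n, and it is
      an integer multiple of n q; cancelling n q, which is nonzero, makes b_n an integer.\<close>
    from log_derivs_leading_coeff[OF w less.prems this]
    obtain k where "fps_nth w n = int n * q * k" by auto
    with wm[of n] less.prems have "of_int q * of_nat n * b n = of_int q * of_nat n * of_int k"
      by auto
    then have "b n = of_int k" using q less.prems by auto
    then show ?case by simp
  qed
qed

section \<open>The image of (M^q(x,m)) under phi_q, and its specialisations\<close>

text \<open>A left and a right inverse coincide. The recursive form makes visible that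
  \<open>mu_q d e\<close> vanishes unless \<open>e\<close> divides \<open>d\<close>.\<close>

lemma mu_q_eq_rinv: "mu_q = rinv zeta_q"
proof -
  have z: "unitriangular zeta_q" by (auto simp: unitriangular_def zeta_q_def)
  have rf: "row_finite mu_q" "row_finite zeta_q" "row_finite (rinv zeta_q)"
    using mu_q_inverse z unitriangular_rinv unitriangular_row_finite
    by (auto simp: is_matrix_inverse_def)
  have "mu_q = matrix_prod mu_q (matrix_prod zeta_q (rinv zeta_q))"
    by (simp add: matrix_prod_rinv[OF z] matrix_prod_one_right[OF rf(1)])
  also have "\<dots> = rinv zeta_q"
    using mu_q_inverse
    by (simp add: matrix_prod_assoc[OF rf(1,2), symmetric] is_matrix_inverse_def
        matrix_prod_one_left[OF rf(3)])
  finally show ?thesis .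
qed

text \<open>Up to the factor 1/d, \<open>M_q\<close> is \<open>mu_q\<close> applied to the sequence
  q^(e-1) x^e; the weights on the left apply \<open>zeta_q\<close>, which undoes it.\<close>

lemma sum_M_q:
  assumes "n \<ge> 1"
  shows "(\<Sum>d | d dvd n. of_nat d * var_q ^ (n div d - 1) * M_q d) = var_q ^ (n - 1) * var_x ^ n"
proof -
  define a where "a e = var_q ^ (e - 1) * var_x ^ e" for e
  have mu0: "mu_q d e = 0" if "\<not> e dvd d" for d e
    unfolding mu_q_eq_rinv by (rule unitriangular_zero[OF unitriangular_rinv]) (use that in simp)
  have fin: "finite {d. d dvd n}" using assms by simp
  have "(\<Sum>d | d dvd n. of_nat d * var_q ^ (n div d - 1) * M_q d) =
      (\<Sum>d | d dvd n. \<Sum>e | e dvd n. [:zeta_q n d * mu_q d e:] * a e)"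
  proof (rule sum.cong)
    fix d assume "d \<in> {d. d dvd n}"
    then have d: "d dvd n" "d \<ge> 1" using assms by (auto intro!: Nat.gr0I)
    have "of_nat d * var_q ^ (n div d - 1) * M_q d = [:zeta_q n d:] * (of_nat d * M_q d)"
      using d assms by (simp add: zeta_q_def var_q_def poly_const_pow)
    also have "of_nat d * M_q d = (\<Sum>e | e dvd d. [:mu_q d e:] * a e)"
      unfolding M_q_def of_nat_mult_smult_inverse[OF d(2)] a_def by (simp add: mult.assoc)
    \<comment> \<open>Summing over all divisors of \<open>n\<close> makes the range of
      \<open>e\<close> independent of \<open>d\<close>, so that the sums can be
      interchanged.\<close>
    also have "\<dots> = (\<Sum>e | e dvd n. [:mu_q d e:] * a e)"
      by (rule sum.mono_neutral_left) (use fin d mu0 in \<open>auto intro: dvd_trans\<close>)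
    finally show "of_nat d * var_q ^ (n div d - 1) * M_q d =
        (\<Sum>e | e dvd n. [:zeta_q n d * mu_q d e:] * a e)"
      by (simp add: sum_distrib_left mult.assoc mult.commute)
  qed simp
  also have "\<dots> = (\<Sum>e | e dvd n. [:\<Sum>d | d dvd n. zeta_q n d * mu_q d e:] * a e)"
    by (subst sum.swap) (simp add: sum_distrib_right smult_sum)
  also have "\<dots> = (\<Sum>e | e dvd n. if e = n then a n else 0)"
  proof (rule sum.cong)
    fix e assume "e \<in> {d. d dvd n}"
    have "(\<Sum>d | d dvd n. zeta_q n d * mu_q d e) = matrix_prod zeta_q mu_q n e"
      by (rule matrix_prod_superset[symmetric]) (use fin in \<open>auto simp: zeta_q_def split: if_splits\<close>)
    also have "\<dots> = matrix_one n e"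
      using mu_q_inverse by (simp add: is_matrix_inverse_def)
    finally show "[:\<Sum>d | d dvd n. zeta_q n d * mu_q d e:] * a e = (if e = n then a n else 0)"
      using assms by (auto simp: matrix_one_def)
  qed simp
  also have "\<dots> = a n" using fin by simp
  finally show ?thesis by (simp add: a_def)
qed

text \<open>The substitution x = p with \<open>p\<close> in Q[q]; it will be used with
  \<open>p\<close> a power of q.\<close>

lemma poly_M_q_sum:
  fixes p :: "rat poly"
  assumes "n \<ge> 1"
  shows "(\<Sum>d | d dvd n. of_nat d * [:0, 1:] ^ (n div d - 1) * poly (M_q d) p) =
    [:0, 1:] ^ (n - 1) * p ^ n"
  using arg_cong[OF sum_M_q[OF assms], of "\<lambda>f. poly f p"]
  by (simp add: poly_sum var_q_def var_x_def)

text \<open>The substitution x = p with \<open>p\<close> in Q[q][x]; it will be used with p =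
  x^r.\<close>

lemma pcompose_M_q_sum:
  assumes "n \<ge> 1"
  shows "(\<Sum>d | d dvd n. of_nat d * var_q ^ (n div d - 1) * pcompose (M_q d) p) =
    var_q ^ (n - 1) * p ^ n"
proof -
  have "pcompose var_q p = var_q" "pcompose var_x p = p"
    by (simp_all add: var_q_def var_x_def pcompose_pCons)
  moreover have "pcompose (f ^ k) p = pcompose f p ^ k" for f k
    by (induction k) (simp_all add: pcompose_mult pcompose_1)
  moreover have "pcompose (of_nat d) p = of_nat d" for d
    by (simp add: of_nat_poly)
  ultimately show ?thesis
    using arg_cong[OF sum_M_q[OF assms], of "\<lambda>f. pcompose f p"]
    by (simp add: pcompose_sum pcompose_mult)
qed

text \<open>At q = k the substitution x = q^N becomes x = k^N, again an integer, so the values solve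
  the necklace equations with integer parameters.\<close>

lemma numerical_poly_M_q:
  assumes "n \<ge> 1"
  shows "numerical_poly (poly (M_q n) ([:0, 1:] ^ N))"
  unfolding numerical_poly_def
proof
  fix k :: int
  show "poly (poly (M_q n) ([:0, 1:] ^ N)) (of_int k) \<in> \<int>"
  proof (rule q_necklace_solution_Ints[OF _ assms, where q = k and x = "k ^ N"])
    fix m :: nat assume "m \<ge> 1"
    from arg_cong[OF poly_M_q_sum[OF this, of "[:0, 1:] ^ N"], of "\<lambda>f. poly f (of_int k)"]
    show "(\<Sum>d | d dvd m. of_nat d * of_int k ^ (m div d - 1) *
        poly (poly (M_q d) ([:0, 1:] ^ N)) (of_int k)) = of_int (k ^ (m - 1) * (k ^ N) ^ m)"
      by (simp add: poly_sum)
  qed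
qed

section \<open>Computation of the q-restriction\<close>

theorem mainTheorem6:
  fixes r :: nat
  assumes "r \<ge> 1"
  shows "\<exists>Q :: nat \<Rightarrow> nat \<Rightarrow> rat poly.
    (\<forall>n\<ge>1. \<forall>d. d dvd n \<longrightarrow> numerical_poly (Q n d)) \<and>
    (\<forall>n\<ge>1. q_Res r (\<lambda>m\<in>{1..}. M_q m) n =
       (\<Sum>d | d dvd n. [:Q n d:] * pcompose (M_q d) (var_x ^ r)))"
proof -
  \<comment> \<open>\<open>B e m\<close> is M^q(q^((r-1)e), m). It is forced by comparing
    coefficients of \<open>L e\<close> in the desired identity for \<open>phi_q b\<close>: with d =
    e c and n = e m, the resulting equations are the necklace equations at x = q^((r-1)e).\<close>
  define B :: "nat \<Rightarrow> nat \<Rightarrow> rat poly" where "B e m = poly (M_q m) ([:0, 1:] ^ ((r - 1) * e))" for e m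
  define Q :: "nat \<Rightarrow> nat \<Rightarrow> rat poly" where "Q n d = B d (n div d)" for n d
  define L where "L d = pcompose (M_q d) (var_x ^ r)" for d
  define b where "b = (\<lambda>n\<in>{1..}. \<Sum>d | d dvd n. [:Q n d:] * L d)"
  have num: "numerical_poly (Q n d)" if "n \<ge> 1" "d dvd n" for n d
    unfolding Q_def B_def by (rule numerical_poly_M_q) (use that in \<open>auto elim!: dvdE\<close>)
  have Qsum: "(\<Sum>d | d dvd n \<and> e dvd d. of_nat d * [:0, 1:] ^ (n div d - 1) * Q d e) =
      of_nat e * [:0, 1:] ^ (n div e - 1 + (r - 1) * n)" if n: "n \<ge> 1" "e dvd n" for n e
  proof -
    obtain m where m: "n = e * m" using n by blast
    then have e: "e \<ge> 1" "m \<ge> 1" using n by (auto intro!: Nat.gr0I)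
    have "(\<Sum>d | d dvd n \<and> e dvd d. of_nat d * [:0, 1:] ^ (n div d - 1) * Q d e) =
        (\<Sum>c | c dvd m. of_nat (e * c) * [:0, 1:] ^ (m div c - 1) * B e c)"
      by (rule sum.reindex_bij_witness[of _ "\<lambda>c. e * c" "\<lambda>d. d div e"])
        (use e in \<open>auto simp: m Q_def elim!: dvdE\<close>)
    also have "\<dots> = of_nat e * (\<Sum>c | c dvd m. of_nat c * [:0, 1:] ^ (m div c - 1) * B e c)"
      by (simp add: sum_distrib_left mult.assoc)
    also have "\<dots> = of_nat e * ([:0, 1:] ^ (m - 1) * ([:0, 1:] ^ ((r - 1) * e)) ^ m)"
      unfolding B_def by (subst poly_M_q_sum[OF e(2)]) simp
    also have "\<dots> = of_nat e * [:0, 1:] ^ (n div e - 1 + (r - 1) * n)"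
      using e by (simp add: m mult_ac flip: power_add power_mult)
    finally show ?thesis .
  qed
  have phi_M: "phi_q (\<lambda>m\<in>{1..}. M_q m) n = var_q ^ (n - 1) * var_x ^ n" if "n \<ge> 1" for n
    using that unfolding phi_q_def
    by (subst sum_M_q[OF that, symmetric]) (auto intro!: sum.cong Nat.gr0I simp: Suc_le_eq)
  have "phi_q b n = F_op r (phi_q (\<lambda>m\<in>{1..}. M_q m)) n" for n
  proof (cases "n \<ge> 1")
    case n: True
    have fin: "finite {d. d dvd n}" using n by simp
    \<comment> \<open>The condition \<open>e dvd n\<close> follows from \<open>e dvd d\<close> and
      \<open>d dvd n\<close>; stating it gives both sums the same outer index set for the
      interchange.\<close>
    have "phi_q b n = (\<Sum>d | d dvd n. \<Sum>e | e dvd n \<and> e dvd d.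
        of_nat d * var_q ^ (n div d - 1) * ([:Q d e:] * L e))"
    proof -
      have "of_nat d * var_q ^ (n div d - 1) * b d = (\<Sum>e | e dvd n \<and> e dvd d.
        of_nat d * var_q ^ (n div d - 1) * ([:Q d e:] * L e))" if "d dvd n" for d
      proof -
        have "d \<ge> 1" using that n by (auto intro!: Nat.gr0I)
        moreover have "{e. e dvd d} = {e. e dvd n \<and> e dvd d}" using that by (auto intro: dvd_trans)
        ultimately show ?thesis by (simp add: b_def sum_distrib_left)
      qed
      then show ?thesis using n by (simp add: phi_q_def)
    qed
    also have "\<dots> = (\<Sum>e | e dvd n. \<Sum>d | d dvd n \<and> e dvd d.
        of_nat d * var_q ^ (n div d - 1) * ([:Q d e:] * L e))"
      using sum.swap_restrict[OF fin fin, of _ "\<lambda>d e. e dvd d"] by simp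
    also have "\<dots> = (\<Sum>e | e dvd n.
        [:\<Sum>d | d dvd n \<and> e dvd d. of_nat d * [:0, 1:] ^ (n div d - 1) * Q d e:] * L e)"
    proof (rule sum.cong)
      fix e
      have "of_nat d * var_q ^ (n div d - 1) * ([:Q d e:] * L e) =
          [:of_nat d * [:0, 1:] ^ (n div d - 1) * Q d e:] * L e" for d
        by (simp add: var_q_def poly_const_pow of_nat_poly mult_ac)
      then show "(\<Sum>d | d dvd n \<and> e dvd d. of_nat d * var_q ^ (n div d - 1) * ([:Q d e:] * L e)) =
          [:\<Sum>d | d dvd n \<and> e dvd d. of_nat d * [:0, 1:] ^ (n div d - 1) * Q d e:] * L e"
        by (simp add: smult_sum)
    qed simp
    \<comment> \<open>By \<open>Qsum\<close> every \<open>L e\<close> carries the same extra power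
      q^((r-1)n). Once it is pulled out, the remaining sum is the necklace sum for \<open>L\<close>,
      known from the substitution x = x^r.\<close>
    also have "\<dots> = (\<Sum>e | e dvd n. var_q ^ ((r - 1) * n) *
        (of_nat e * var_q ^ (n div e - 1) * L e))"
    proof (rule sum.cong)
      fix e assume "e \<in> {d. d dvd n}"
      then have "[:\<Sum>d | d dvd n \<and> e dvd d. of_nat d * [:0, 1:] ^ (n div d - 1) * Q d e:] =
          of_nat e * var_q ^ (n div e - 1 + (r - 1) * n)"
        using Qsum[OF n, of e] by (simp only: mem_Collect_eq) (simp add: var_q_def poly_const_pow of_nat_poly)
      also have "\<dots> = var_q ^ ((r - 1) * n) * (of_nat e * var_q ^ (n div e - 1))"
        by (simp only: power_add mult_ac)
      finally show "[:\<Sum>d | d dvd n \<and> e dvd d. of_nat d * [:0, 1:] ^ (n div d - 1) * Q d e:] * L e =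
          var_q ^ ((r - 1) * n) * (of_nat e * var_q ^ (n div e - 1) * L e)"
        by (simp only: mult.assoc)
    qed simp
    also have "\<dots> = var_q ^ ((r - 1) * n) * (var_q ^ (n - 1) * (var_x ^ r) ^ n)"
      unfolding L_def by (subst pcompose_M_q_sum[OF n, symmetric]) (simp add: sum_distrib_left)
    also have "\<dots> = var_q ^ ((r - 1) * n + (n - 1)) * var_x ^ (r * n)"
      by (simp add: power_add power_mult mult.assoc)
    \<comment> \<open>The subtraction is truncated, so this uses \<open>r \<ge> 1\<close> and
      \<open>n \<ge> 1\<close>. The result is the exponent at index \<open>r * n\<close> of the
      image of \<open>M_q\<close>.\<close>
    also have "(r - 1) * n + (n - 1) = r * n - 1"
      using n assms by (cases r; cases n) auto
    also have "var_q ^ (r * n - 1) * var_x ^ (r * n) = F_op r (phi_q (\<lambda>m\<in>{1..}. M_q m)) n"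
      using n assms phi_M[of "r * n"] by (simp add: F_op_def)
    finally show ?thesis .
  qed (simp add: phi_q_def F_op_def)
  \<comment> \<open>At index 0 both sides are \<open>undefined\<close>, so they agree as functions,
    and injectivity of \<open>phi_q\<close> on \<open>seqs\<close> identifies the restriction with
    \<open>b\<close>.\<close>
  then have "F_op r (phi_q (\<lambda>m\<in>{1..}. M_q m)) = phi_q b" by auto
  moreover have "b \<in> seqs" by (auto simp: b_def seqs_def)
  ultimately have "q_Res r (\<lambda>m\<in>{1..}. M_q m) = b"
    using bij_betw_phi_q by (simp add: q_Res_def bij_betw_def inv_into_f_f)
  then show ?thesis
    using num by (intro exI[of _ Q]) (auto simp: b_def L_def)
qed

end
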